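(* Let $X,Y$ be LCTV spaces, $\phi\colon X\times Y\to\overline{\mathbb R}$ an int-nearly convex function, $F\colon X\rightrightarrows Y$ an int-nearly convex set-valued mapping, and let $\mu(x):=\inf\{\phi(x,y)\mid y\in F(x)\}$ for $x\in X$. Assume that $\operatorname{int}(\operatorname{epi}\phi)\cap\operatorname{int}\big((\operatorname{gph}F)\times\mathbb R\big)\neq\emptyset$. Put $$\mathcal V_p:=\inf\{\phi(0,y)\mid y\in F(0)\},\quad\mathcal V_d^1:=\sup_{x^*\in X^*}\{-\mu^*(x^* )\},\quad\mathcal V_d^2:=\sup_{x^*\in X^*}\{-(\phi^*\square F^* )(x^*,0)\}.$$ Given $x_0^*\in X^*$, the following assertions are equivalent: (i) $x_0^*\in\partial\mu(0)$. (ii) $x_0^*$ is a solution to the problem of maximizing $-\mu^*(x^* )$ subject to $x^*\in X^*$, and $\mathcal V_p=\mathcal V_d^1=\mathcal V_d^2\in\mathbb R$. (iii) $x_0^*$ is a solution to the problem of maximizing $-(\phi^*\square F^* )(x^*,0)$ subject to $x^*\in X^*$, and $\mathcal V_p=\mathcal V_d^1=\mathcal V_d^2\in\mathbb R$.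
   Context: LCTV space means real locally convex Hausdorff topological vector space; $X^*$ is the topological dual, $\langle x^*,x\rangle=x^*(x)$, and $(X\times Y)^*$ is identified with $X^*\times Y^*$. $\overline{\mathbb R}=\mathbb R\cup\{-\infty\}\cup\{\infty\}$ and $\inf\emptyset=\infty$. $\operatorname{epi}f=\{(x,\lambda)\in X\times\mathbb R\mid f(x)\le\lambda\}$, $\operatorname{gph}F=\{(x,y)\mid y\in F(x)\}$. A set $\Omega$ is int-nearly convex if there is a convex set $C$ with $\operatorname{int}C\ne\emptyset$ and $C\subset\Omega\subset\overline C$; a function (resp. set-valued mapping) is int-nearly convex if its epigraph (resp. graph) is. $f^*(x^* )=\sup\{\langle x^*,x\rangle-f(x)\mid x\in X\}$ is the Fenchel conjugate of a function and $F^*(x^*,y^* )=\sup\{\langle x^*,x\rangle+\langle y^*,y\rangle\mid(x,y)\in\operatorname{gph}F\}$ that of the set-valued mapping $F$. $(\phi^*\square F^* )(x^*,0)=\inf\{\phi^*(x_1^*,y^* )+F^*(x_2^*,-y^* )\mid x_1^*+x_2^*=x^*,\ x_1^*,x_2^*\in X^*,\ y^*\in Y^*\}$. $\partial\mu(0)=\{x^*\in X^*\mid\langle x^*,x\rangle\le\mu(x)-\mu(0)\ \forall x\in X\}$ if $\mu(0)\in\mathbb R$, and $\emptyset$ otherwise. A solution of a maximization problem is a feasible element at which the supremum is attained. *)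

theory Defs
  imports "HOL-Analysis.Analysis"
begin

(* The last assumption is local convexity at 0; "convex V" is unfolded because the constant convex,
   which lives on the class real_vector, cannot be used inside a class specification. *)
class lctv_space = real_vector + topological_ab_group_add + t2_space +
  assumes tendsto_scaleR_nhds:
    "((\<lambda>p. fst p *\<^sub>R snd p) \<longlongrightarrow> c *\<^sub>R x) (nhds c \<times>\<^sub>F nhds x)"
  and locally_convex_at_0_raw:
    "open U \<Longrightarrow> 0 \<in> U \<Longrightarrow>
       \<exists>V. open V \<and> 0 \<in> V \<and> V \<subseteq> U \<and>
           (\<forall>x\<in>V. \<forall>y\<in>V. \<forall>u\<ge>0. \<forall>v\<ge>0. u + v = 1 \<longrightarrow> u *\<^sub>R x + v *\<^sub>R y \<in> V)"

lemma locally_convex_at_0: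
  fixes U :: "'a::lctv_space set"
  assumes "open U" "0 \<in> U"
  shows "\<exists>V. open V \<and> 0 \<in> V \<and> V \<subseteq> U \<and> convex V"
  unfolding convex_def using locally_convex_at_0_raw[OF assms] .

instance real_normed_vector \<subseteq> lctv_space
proof
  show "((\<lambda>p. fst p *\<^sub>R snd p) \<longlongrightarrow> c *\<^sub>R x) (nhds c \<times>\<^sub>F nhds x)" for c :: real and x :: 'a
    by (intro tendsto_scaleR filterlim_fst filterlim_snd)
next
  fix U :: "'a set"
  assume "open U" "0 \<in> U"
  then obtain e where "e > 0" "ball 0 e \<subseteq> U"
    by (auto simp: open_contains_ball)
  then show "\<exists>V. open V \<and> 0 \<in> V \<and> V \<subseteq> U \<and>
      (\<forall>x\<in>V. \<forall>y\<in>V. \<forall>u\<ge>0. \<forall>v\<ge>0. u + v = 1 \<longrightarrow> u *\<^sub>R x + v *\<^sub>R y \<in> V)"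
    using convex_ball[of "0::'a" e] unfolding convex_def
    by (intro exI[of _ "ball 0 e"] conjI) simp_all
qed

definition topological_dual :: "('a::lctv_space \<Rightarrow> real) set" where
  "topological_dual = {f. linear f \<and> continuous_on UNIV f}"

definition epi :: "('a \<Rightarrow> ereal) \<Rightarrow> ('a \<times> real) set" where
  "epi f = {(x, r). f x \<le> ereal r}"

definition gph :: "('a \<Rightarrow> 'b set) \<Rightarrow> ('a \<times> 'b) set" where
  "gph F = {(x, y). y \<in> F x}"

definition int_nearly_convex_set :: "'a::{real_vector,topological_space} set \<Rightarrow> bool" where
  "int_nearly_convex_set S \<longleftrightarrow>
     (\<exists>C. convex C \<and> interior C \<noteq> {} \<and> C \<subseteq> S \<and> S \<subseteq> closure C)"

definition int_nearly_convex_fun :: "('a::{real_vector,topological_space} \<Rightarrow> ereal) \<Rightarrow> bool" where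
  "int_nearly_convex_fun f \<longleftrightarrow> int_nearly_convex_set (epi f)"

definition int_nearly_convex_map ::
    "('a::{real_vector,topological_space} \<Rightarrow> 'b::{real_vector,topological_space} set) \<Rightarrow> bool" where
  "int_nearly_convex_map F \<longleftrightarrow> int_nearly_convex_set (gph F)"

definition fenchel_conj :: "('a \<Rightarrow> ereal) \<Rightarrow> ('a \<Rightarrow> real) \<Rightarrow> ereal" where
  "fenchel_conj f xs = (SUP x. ereal (xs x) - f x)"

(* Identifies a pair of functionals on X and Y with a functional on X x Y. *)
definition pair_functional :: "('a \<Rightarrow> real) \<Rightarrow> ('b \<Rightarrow> real) \<Rightarrow> 'a \<times> 'b \<Rightarrow> real" where
  "pair_functional xs ys = (\<lambda>(x, y). xs x + ys y)"

definition map_conj :: "('a \<Rightarrow> 'b set) \<Rightarrow> ('a \<Rightarrow> real) \<Rightarrow> ('b \<Rightarrow> real) \<Rightarrow> ereal" where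
  "map_conj F xs ys = (SUP (x, y) \<in> gph F. ereal (xs x + ys y))"

(* The infimal convolution of the conjugates of \<phi> and F at the point (xs, 0).
   If gph F and epi \<phi> are nonempty, both summands are greater than -\<infinity>, so the convention \<infinity> + (-\<infinity>) = \<infinity> of ereal plays no role. *)
definition conj_inf_conv ::
    "('a::lctv_space \<times> 'b::lctv_space \<Rightarrow> ereal) \<Rightarrow> ('a \<Rightarrow> 'b set) \<Rightarrow> ('a \<Rightarrow> real) \<Rightarrow> ereal" where
  "conj_inf_conv \<phi> F xs =
     Inf {fenchel_conj \<phi> (pair_functional x1 ys) + map_conj F x2 (\<lambda>y. - ys y) | x1 x2 ys.
          x1 \<in> topological_dual \<and> x2 \<in> topological_dual \<and> ys \<in> topological_dual \<and>
          (\<lambda>x. x1 x + x2 x) = xs}"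

definition subdiff_at_0 :: "('a::lctv_space \<Rightarrow> ereal) \<Rightarrow> ('a \<Rightarrow> real) set" where
  "subdiff_at_0 f =
     (if \<bar>f 0\<bar> \<noteq> \<infinity> then {xs \<in> topological_dual. \<forall>x. ereal (xs x) \<le> f x - f 0} else {})"

definition solves_max :: "('c \<Rightarrow> ereal) \<Rightarrow> 'c set \<Rightarrow> 'c \<Rightarrow> bool" where
  "solves_max g S x \<longleftrightarrow> x \<in> S \<and> g x = (SUP z \<in> S. g z)"

end

theory Submission
  imports Defs
begin

text \<open>
The heart of the matter is the identity \<open>\<mu>\<^sup>*(x\<^sup>*) = (\<phi>\<^sup>* \<box> F\<^sup>*)(x\<^sup>*, 0)\<close> for every continuous \<open>x\<^sup>*\<close>. It
makes the two dual problems literally the same problem. What remains is the general fact that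
\<open>x\<^sup>* \<in> \<partial>\<mu>(0)\<close> iff \<open>- \<mu>\<^sup>*(x\<^sup>*) = \<mu>(0)\<close> with \<open>\<mu>(0)\<close> finite (\<open>subdiff_at_0_iff\<close>). Since
\<open>- \<mu>\<^sup>*(x\<^sup>*) \<le> \<mu>(0)\<close> holds for all \<open>x\<^sup>*\<close>, and \<open>\<mu>(0)\<close> is the primal value, this equality expresses
both that \<open>x\<^sup>*\<close> solves the dual problem and that there is no duality gap.

In the identity, \<open>\<le>\<close> is the Fenchel--Young inequality (\<open>fenchel_conj_marginal_le_conj_inf_conv\<close>). For
\<open>\<ge>\<close> (\<open>conj_inf_conv_le_fenchel_conj_marginal\<close>), a bound on \<open>\<mu>\<^sup>*(x\<^sup>*)\<close> makes the epigraph of \<open>\<phi>\<close>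
disjoint from a strict hypograph of an affine function over the graph of \<open>F\<close>. A hyperplane
separates these sets in \<open>(X \<times> Y) \<times> \<real>\<close>, the qualification condition prevents it from being vertical,
and its normal vector splits \<open>x\<^sup>*\<close> as the infimal convolution requires. Near-convexity is enough
because separating the convex kernels also separates their closures.

The separation theorem for locally convex spaces (\<open>separation_of_convex_sets\<close>) is obtained
from a maximal convex cone that avoids \<open>0\<close>: such a cone is the positive cone of a total order, and an
order unit of this order defines a positive linear functional.
\<close>

section \<open>Total convex cones and positive functionals\<close>

text \<open>A Hahn--Banach argument by way of order. The cone generated by \<open>D\<close> avoids \<open>0\<close> because
\<open>D\<close> is convex, so Zorn's lemma gives a largest convex cone \<open>K\<close> around \<open>D\<close> that avoids
\<open>0\<close>. If neither \<open>x\<close> nor \<open>- x\<close> belonged to it, the ray through \<open>x\<close> could still be added.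
Hence \<open>x < y\<close> iff \<open>y - x \<in> K\<close> is a total order compatible with the linear structure.\<close>
lemma total_convex_cone_extension:
  fixes D :: "'a::real_vector set"
  assumes "convex D" and "0 \<notin> D"
  obtains K where "D \<subseteq> K" "0 \<notin> K"
    "\<And>x y. x \<in> K \<Longrightarrow> y \<in> K \<Longrightarrow> x + y \<in> K"
    "\<And>c x. c > 0 \<Longrightarrow> x \<in> K \<Longrightarrow> c *\<^sub>R x \<in> K"
    "\<And>x. x \<noteq> 0 \<Longrightarrow> x \<in> K \<or> - x \<in> K"
proof -
  define blunt where "blunt K \<longleftrightarrow> 0 \<notin> K \<and> (\<forall>x\<in>K. \<forall>y\<in>K. x + y \<in> K) \<and> (\<forall>c>0. \<forall>x\<in>K. c *\<^sub>R x \<in> K)"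
    for K :: "'a set"
  define cones where "cones = {K. D \<subseteq> K \<and> blunt K}"
  define K0 where "K0 = {c *\<^sub>R d | c d. c > 0 \<and> d \<in> D}"
  have K0: "K0 \<in> cones"
  proof -
    have "x + y \<in> K0" if "x \<in> K0" "y \<in> K0" for x y
    proof -
      obtain a u where x: "a > 0" "u \<in> D" "x = a *\<^sub>R u" using \<open>x \<in> K0\<close> unfolding K0_def by blast
      obtain b v where y: "b > 0" "v \<in> D" "y = b *\<^sub>R v" using \<open>y \<in> K0\<close> unfolding K0_def by blast
      let ?m = "(a / (a + b)) *\<^sub>R u + (b / (a + b)) *\<^sub>R v"
      have "?m \<in> D"
        using x y by (intro convexD[OF \<open>convex D\<close>]) (auto simp flip: add_divide_distrib)
      moreover have "x + y = (a + b) *\<^sub>R ?m"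
        using x y by (simp add: scaleR_right_distrib)
      ultimately show ?thesis unfolding K0_def using x(1) y(1) add_pos_pos by blast
    qed
    moreover have "c *\<^sub>R x \<in> K0" if "c > 0" "x \<in> K0" for c x
    proof -
      obtain a u where x: "a > 0" "u \<in> D" "x = a *\<^sub>R u" using \<open>x \<in> K0\<close> unfolding K0_def by blast
      then have "c * a > 0" "c *\<^sub>R x = (c * a) *\<^sub>R u" using \<open>c > 0\<close> by auto
      then show ?thesis unfolding K0_def using x(2) by blast
    qed
    moreover have "0 \<notin> K0" using \<open>0 \<notin> D\<close> by (auto simp: K0_def)
    moreover have "D \<subseteq> K0"
    proof
      fix d assume "d \<in> D"
      then have "1 *\<^sub>R d \<in> K0" unfolding K0_def using zero_less_one by blast
      then show "d \<in> K0" by simp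
    qed
    ultimately show ?thesis by (auto simp: cones_def blunt_def)
  qed
  have "\<exists>M\<in>cones. \<forall>X\<in>cones. M \<subseteq> X \<longrightarrow> X = M"
  proof (rule subset_Zorn_nonempty)
    show "cones \<noteq> {}" using K0 by blast
  next
    fix \<C> assume ne: "\<C> \<noteq> {}" and ch: "subset.chain cones \<C>"
    then have cones: "\<And>X. X \<in> \<C> \<Longrightarrow> D \<subseteq> X \<and> blunt X" and tot: "\<And>X Y. X \<in> \<C> \<Longrightarrow> Y \<in> \<C> \<Longrightarrow> X \<subseteq> Y \<or> Y \<subseteq> X"
      by (auto simp: subset_chain_def cones_def)
    have "x + y \<in> \<Union>\<C>" if xy: "x \<in> \<Union>\<C>" "y \<in> \<Union>\<C>" for x y
    proof -
      obtain X Y where "X \<in> \<C>" "Y \<in> \<C>" "x \<in> X" "y \<in> Y" using xy by blast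
      then obtain Z where "Z \<in> \<C>" "x \<in> Z" "y \<in> Z" using tot by blast
      then show ?thesis using cones unfolding blunt_def by blast
    qed
    moreover have "0 \<notin> \<Union>\<C>" "\<And>c x. c > 0 \<Longrightarrow> x \<in> \<Union>\<C> \<Longrightarrow> c *\<^sub>R x \<in> \<Union>\<C>" "D \<subseteq> \<Union>\<C>"
      using cones ne unfolding blunt_def by blast+
    ultimately show "\<Union>\<C> \<in> cones" by (simp add: cones_def blunt_def)
  qed
  then obtain K where K: "D \<subseteq> K" "blunt K" and max: "\<And>X. X \<in> cones \<Longrightarrow> K \<subseteq> X \<Longrightarrow> X = K"
    by (auto simp: cones_def)
  have add: "x + y \<in> K" if "x \<in> K" "y \<in> K" for x y using K that by (auto simp: blunt_def)
  have scale: "c *\<^sub>R x \<in> K" if "c > 0" "x \<in> K" for c x using K that by (auto simp: blunt_def)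
  have "x \<in> K \<or> - x \<in> K" if "x \<noteq> 0" for x
  proof (rule ccontr)
    assume not: "\<not> (x \<in> K \<or> - x \<in> K)"
    \<comment> \<open>the cone generated by \<open>K\<close> and \<open>x\<close>, without the point \<open>0\<close>\<close>
    define X where "X = K \<union> {k + t *\<^sub>R x | k t. k \<in> insert 0 K \<and> t > 0}"
    have "blunt X"
      unfolding blunt_def
    proof (intro conjI ballI allI impI)
      show "0 \<notin> X"
      proof
        assume "0 \<in> X"
        then obtain k t where kt: "k \<in> insert 0 K" "t > 0" "0 = k + t *\<^sub>R x"
          using K by (auto simp: X_def blunt_def)
        then have "k = t *\<^sub>R (- x)" by (simp add: eq_neg_iff_add_eq_0)
        with kt that have "k \<in> K" by auto
        with scale[of "1 / t" k] kt \<open>k = t *\<^sub>R (- x)\<close> have "- x \<in> K" by simp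
        with not show False by blast
      qed
    next
      fix c y assume "(c::real) > 0" "y \<in> X"
      show "c *\<^sub>R y \<in> X"
      proof (cases "y \<in> K")
        case True then show ?thesis using scale \<open>c > 0\<close> by (simp add: X_def)
      next
        case False
        then obtain k t where "k \<in> insert 0 K" "t > 0" "y = k + t *\<^sub>R x" using \<open>y \<in> X\<close> by (auto simp: X_def)
        then have "c *\<^sub>R k \<in> insert 0 K" "c * t > 0" "c *\<^sub>R y = c *\<^sub>R k + (c * t) *\<^sub>R x"
          using scale \<open>c > 0\<close> by (auto simp: scaleR_right_distrib)
        then show ?thesis unfolding X_def by blast
      qed
    next
      \<comment> \<open>both parts of \<open>X\<close> in one form; \<open>k = 0\<close> and \<open>t = 0\<close> must not occur together\<close>
      have rep: "\<exists>k t. k \<in> insert 0 K \<and> t \<ge> 0 \<and> (t = 0 \<longrightarrow> k \<in> K) \<and> y = k + t *\<^sub>R x" if y: "y \<in> X" for y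
      proof (cases "y \<in> K")
        case True
        then show ?thesis by (intro exI[of _ y] exI[of _ "0::real"]) auto
      next
        case False
        then obtain k t where "k \<in> insert 0 K" "t > 0" "y = k + t *\<^sub>R x" using y by (auto simp: X_def)
        then show ?thesis by (intro exI[of _ k] exI[of _ t]) auto
      qed
      fix y z assume "y \<in> X" "z \<in> X"
      obtain k t where y: "k \<in> insert 0 K" "t \<ge> 0" "t = 0 \<longrightarrow> k \<in> K" "y = k + t *\<^sub>R x" using rep[OF \<open>y \<in> X\<close>] by blast
      obtain l s where z: "l \<in> insert 0 K" "s \<ge> 0" "s = 0 \<longrightarrow> l \<in> K" "z = l + s *\<^sub>R x" using rep[OF \<open>z \<in> X\<close>] by blast
      have eq: "y + z = (k + l) + (t + s) *\<^sub>R x" using y z by (simp add: algebra_simps)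
      show "y + z \<in> X"
      proof (cases "t + s = 0")
        case True
        then have "y + z = k + l" "k \<in> K" "l \<in> K" using eq y z by auto
        then show ?thesis using add by (simp add: X_def)
      next
        case False
        then have "t + s > 0" using y z by linarith
        moreover have "k + l \<in> insert 0 K" using y z add by auto
        ultimately show ?thesis unfolding X_def using eq by blast
      qed
    qed
    moreover have "K \<subseteq> X" by (auto simp: X_def)
    ultimately have "X = K" using K by (intro max) (auto simp: cones_def)
    moreover have "0 + 1 *\<^sub>R x \<in> X" unfolding X_def using zero_less_one by blast
    ultimately show False using not by simp
  qed
  then show thesis using that[of K] K add scale by (auto simp: blunt_def)
qed

text \<open>In the total order of \<open>K\<close>, every \<open>x\<close> cuts the line of multiples of the order unit
\<open>e\<close> at a single real number, the largest \<open>t\<close> with \<open>t e \<le> x\<close> up to an arbitrarily small error.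
Totality makes this number approximable from both sides, and cones are closed under addition, so
the number is additive and not only superadditive in \<open>x\<close>.\<close>
lemma total_cone_positive_functional:
  fixes K :: "'a::real_vector set"
  assumes zero: "0 \<notin> K"
    and add: "\<And>x y. x \<in> K \<Longrightarrow> y \<in> K \<Longrightarrow> x + y \<in> K"
    and scale: "\<And>c x. c > 0 \<Longrightarrow> x \<in> K \<Longrightarrow> c *\<^sub>R x \<in> K"
    and total: "\<And>x. x \<noteq> 0 \<Longrightarrow> x \<in> K \<or> - x \<in> K"
    and unit: "\<And>x. \<exists>s. s *\<^sub>R e - x \<in> K"
    and e: "e \<in> K"
  obtains f where "linear f" "f e = (1::real)" "\<And>x. x \<in> K \<Longrightarrow> f x \<ge> 0"
proof -
  define L where "L x = {t. x - t *\<^sub>R e \<in> K}" for x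
  define f where "f x = Sup (L x)" for x
  have pos: "c > 0" if "c *\<^sub>R e \<in> K" for c
  proof (rule ccontr)
    assume "\<not> c > 0"
    then consider "c = 0" | "- c > 0" by linarith
    then show False
    proof cases
      case 1 then show False using that zero by simp
    next
      case 2
      then have "c *\<^sub>R e + (- c) *\<^sub>R e \<in> K" by (intro add that scale[OF _ e])
      then show False using zero by simp
    qed
  qed
  have ne: "L x \<noteq> {}" for x
  proof -
    obtain s where "s *\<^sub>R e - (- x) \<in> K" using unit by blast
    then have "- s \<in> L x" by (simp add: L_def add.commute)
    then show ?thesis by blast
  qed
  have upper: "t < s" if "t \<in> L x" "s *\<^sub>R e - x \<in> K" for t s x
  proof -
    have "(x - t *\<^sub>R e) + (s *\<^sub>R e - x) \<in> K" using that by (intro add) (auto simp: L_def)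
    then have "(s - t) *\<^sub>R e \<in> K" by (simp add: algebra_simps)
    then show ?thesis using pos by force
  qed
  have bdd: "bdd_above (L x)" for x
    using unit[of x] upper by (meson bdd_aboveI less_imp_le)
  have below: "x - t *\<^sub>R e \<in> K" if t: "t < f x" for t x
  proof -
    obtain s where s: "s \<in> L x" "t < s"
      using t less_cSup_iff[OF ne bdd] by (auto simp: f_def)
    have "(x - s *\<^sub>R e) + (s - t) *\<^sub>R e \<in> K" using s by (intro add scale e) (auto simp: L_def)
    then show ?thesis by (simp add: algebra_simps)
  qed
  have above: "t *\<^sub>R e - x \<in> K" if t: "f x < t" for t x
  proof -
    obtain s where s: "f x < s" "s < t" using dense t by blast
    have "s \<notin> L x" using cSup_upper[OF _ bdd] s by (force simp: f_def)
    then have "x - s *\<^sub>R e \<notin> K" by (simp add: L_def)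
    then have "x - s *\<^sub>R e = 0 \<or> s *\<^sub>R e - x \<in> K" using total[of "x - s *\<^sub>R e"] by auto
    then show ?thesis
    proof
      assume "x - s *\<^sub>R e = 0"
      then have "t *\<^sub>R e - x = (t - s) *\<^sub>R e" by (simp add: algebra_simps)
      then show ?thesis using scale[OF _ e, of "t - s"] s by simp
    next
      assume "s *\<^sub>R e - x \<in> K"
      then have "(s *\<^sub>R e - x) + (t - s) *\<^sub>R e \<in> K" using s by (intro add scale e) auto
      then show ?thesis by (simp add: algebra_simps)
    qed
  qed
  have low: "t \<le> f x" if "x - t *\<^sub>R e \<in> K" for t x
    using cSup_upper[OF _ bdd] that by (simp add: f_def L_def)
  have upp: "f x \<le> t" if "t *\<^sub>R e - x \<in> K" for t x
    using cSup_least[OF ne, of x t] upper that by (auto simp: f_def less_imp_le)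
  have f_add: "f (x + y) = f x + f y" for x y
  proof (rule antisym)
    show "f x + f y \<le> f (x + y)"
    proof (rule field_le_epsilon)
      fix \<epsilon> :: real assume "\<epsilon> > 0"
      then have "(x - (f x - \<epsilon>/2) *\<^sub>R e) + (y - (f y - \<epsilon>/2) *\<^sub>R e) \<in> K"
        by (intro add below) auto
      then have "(x + y) - (f x + f y - \<epsilon>) *\<^sub>R e \<in> K"
        by (simp add: algebra_simps flip: scaleR_add_left)
      then show "f x + f y \<le> f (x + y) + \<epsilon>" using low by force
    qed
    show "f (x + y) \<le> f x + f y"
    proof (rule field_le_epsilon)
      fix \<epsilon> :: real assume "\<epsilon> > 0"
      then have "((f x + \<epsilon>/2) *\<^sub>R e - x) + ((f y + \<epsilon>/2) *\<^sub>R e - y) \<in> K"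
        by (intro add above) auto
      then have "(f x + f y + \<epsilon>) *\<^sub>R e - (x + y) \<in> K"
        by (simp add: algebra_simps flip: scaleR_add_left)
      then show "f (x + y) \<le> f x + f y + \<epsilon>" by (rule upp)
    qed
  qed
  have f0: "f 0 = 0" using f_add[of 0 0] by simp
  have f_minus: "f (- x) = - f x" for x using f_add[of x "- x"] f0 by simp
  have f_scale_le: "c * f x \<le> f (c *\<^sub>R x)" if c: "c > 0" for c x
  proof (rule dense_le)
    fix t assume "t < c * f x"
    then have "t / c < f x" using c by (simp add: field_simps)
    then have "c *\<^sub>R (x - (t / c) *\<^sub>R e) \<in> K" by (intro scale c below)
    then show "t \<le> f (c *\<^sub>R x)" using c by (intro low) (simp add: algebra_simps)
  qed
  have f_scale_pos: "f (c *\<^sub>R x) = c * f x" if "c > 0" for c x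
    using f_scale_le[OF that, of x] f_scale_le[OF that, of "- x"] by (simp add: f_minus)
  have f_scale: "f (c *\<^sub>R x) = c * f x" for c x
  proof -
    consider "c > 0" | "c = 0" | "- c > 0" by linarith
    then show ?thesis
    proof cases
      case 3
      then have "f ((- c) *\<^sub>R x) = (- c) * f x" by (rule f_scale_pos)
      then show ?thesis by (simp add: f_minus)
    qed (auto simp: f_scale_pos f0)
  qed
  have "linear f" by (rule linearI) (auto simp: f_add f_scale)
  moreover have "f e = 1"
  proof (rule antisym)
    show "f e \<le> 1"
    proof (rule dense_ge)
      fix t :: real assume "1 < t"
      then have "(t - 1) *\<^sub>R e \<in> K" by (intro scale e) simp
      then show "f e \<le> t" by (intro upp) (simp add: algebra_simps)
    qed
    show "1 \<le> f e"
    proof (rule dense_le)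
      fix t :: real assume "t < 1"
      then have "(1 - t) *\<^sub>R e \<in> K" by (intro scale e) simp
      then show "t \<le> f e" by (intro low) (simp add: algebra_simps)
    qed
  qed
  moreover have "f x \<ge> 0" if "x \<in> K" for x
    using that by (intro low) simp
  ultimately show thesis using that by blast
qed

section \<open>Separation of convex sets\<close>

lemma tendsto_scaleR_lctv:
  fixes g :: "'b \<Rightarrow> 'a::lctv_space"
  assumes "(f \<longlongrightarrow> c) F" "(g \<longlongrightarrow> x) F"
  shows "((\<lambda>z. f z *\<^sub>R g z) \<longlongrightarrow> c *\<^sub>R x) F"
  using filterlim_compose[OF tendsto_scaleR_nhds filterlim_Pair[OF assms]] by simp

lemma continuous_on_scaleR_lctv:
  fixes g :: "'b::topological_space \<Rightarrow> 'a::lctv_space"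
  assumes "continuous_on S f" "continuous_on S g"
  shows "continuous_on S (\<lambda>z. f z *\<^sub>R g z)"
  using assms by (auto simp: continuous_on_def intro: tendsto_scaleR_lctv)

text \<open>The set \<open>U\<close> and its reflection through \<open>e\<close> together bound the functional on both sides
near \<open>e\<close>; translation and scaling carry this bound to any point and any precision.\<close>
lemma linear_continuous_if_bounded_below:
  fixes f :: "'a::lctv_space \<Rightarrow> real"
  assumes f: "linear f" and U: "open U" "e \<in> U" and bound: "\<And>x. x \<in> U \<Longrightarrow> b \<le> f x"
  shows "continuous_on UNIV f"
  unfolding continuous_on_def
proof (intro ballI tendstoI)
  fix x and \<epsilon> :: real assume "\<epsilon> > 0"
  \<comment> \<open>\<open>f\<close> falls by less than \<open>M\<close> on \<open>U\<close>; the summand 1 keeps \<open>M\<close> positive\<close>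
  define M where "M = f e - b + 1"
  have M: "M > 0" using bound[OF \<open>e \<in> U\<close>] by (simp add: M_def)
  define g h where "g y = e + (M / \<epsilon>) *\<^sub>R (y - x)" and "h y = e - (M / \<epsilon>) *\<^sub>R (y - x)" for y
  have "open (g -` U \<inter> h -` U)"
    unfolding g_def h_def
    by (intro open_Int open_vimage U continuous_on_add continuous_on_diff continuous_on_scaleR_lctv
        continuous_on_const continuous_on_id)
  moreover have "x \<in> g -` U \<inter> h -` U" using \<open>e \<in> U\<close> by (simp add: g_def h_def)
  moreover have "dist (f y) (f x) < \<epsilon>" if "y \<in> g -` U \<inter> h -` U" for y
  proof -
    have "b \<le> f (g y)" "b \<le> f (h y)" using that bound by auto
    then have "b \<le> f e + (M / \<epsilon>) * (f y - f x)" "b \<le> f e - (M / \<epsilon>) * (f y - f x)"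
      by (simp_all add: g_def h_def linear_add[OF f] linear_diff[OF f] linear_scale[OF f])
    then have "\<bar>(M / \<epsilon>) * (f y - f x)\<bar> < M" unfolding M_def by linarith
    then have "(M / \<epsilon>) * \<bar>f y - f x\<bar> < (M / \<epsilon>) * \<epsilon>"
      using M \<open>\<epsilon> > 0\<close> by (simp add: abs_mult)
    then have "\<bar>f y - f x\<bar> < \<epsilon>"
      using M \<open>\<epsilon> > 0\<close> by (simp only: mult_less_cancel_left_pos[OF divide_pos_pos])
    then show ?thesis by (simp add: dist_real_def)
  qed
  ultimately show "\<forall>\<^sub>F y in at x within UNIV. dist (f y) (f x) < \<epsilon>"
    by (auto simp: eventually_at_topological)
qed

lemma open_absorbing:
  fixes e :: "'a::lctv_space"
  assumes "open U" "e \<in> U"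
  obtains t where "t > 0" "e + t *\<^sub>R x \<in> U"
proof -
  have "((\<lambda>t. e + t *\<^sub>R x) \<longlongrightarrow> e + 0 *\<^sub>R x) (at_right 0)"
    by (intro tendsto_add tendsto_const tendsto_scaleR_lctv) (auto intro: tendsto_ident_at)
  then have "\<forall>\<^sub>F t in at_right 0. e + t *\<^sub>R x \<in> U"
    using assms by (auto dest!: topological_tendstoD[of _ _ _ U])
  then have "\<forall>\<^sub>F t in at_right (0::real). t > 0 \<and> e + t *\<^sub>R x \<in> U"
    by (intro eventually_conj eventually_at_right_less)
  then show thesis using that eventually_happens'[OF trivial_limit_at_right_real] by blast
qed

text \<open>Disjointness of the two sets means that the convex set of differences avoids \<open>0\<close>, and a
difference with a point interior to \<open>A\<close> is interior to it. Such an interior point is an order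
unit for the total cone around the set of differences, and the positive functional of the cone is
bounded below near it, hence continuous. The witness \<open>d\<close> records that the functional is not zero.\<close>
theorem separation_of_convex_sets:
  fixes A B :: "'a::lctv_space set"
  assumes "convex A" "interior A \<noteq> {}" "convex B" "B \<noteq> {}" "A \<inter> B = {}"
  obtains f \<gamma> d where "f \<in> topological_dual" "f d > 0"
    "\<And>a. a \<in> A \<Longrightarrow> f a \<le> \<gamma>" "\<And>b. b \<in> B \<Longrightarrow> \<gamma> \<le> f b"
proof -
  define D where "D = (\<Union>b\<in>B. \<Union>a\<in>A. {b - a})"
  have "convex D" unfolding D_def by (intro convex_differences assms)
  moreover have "0 \<notin> D" using \<open>A \<inter> B = {}\<close> by (auto simp: D_def)
  ultimately obtain K where K: "D \<subseteq> K" "0 \<notin> K"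
    "\<And>x y. x \<in> K \<Longrightarrow> y \<in> K \<Longrightarrow> x + y \<in> K"
    "\<And>c x. c > 0 \<Longrightarrow> x \<in> K \<Longrightarrow> c *\<^sub>R x \<in> K"
    "\<And>x. x \<noteq> 0 \<Longrightarrow> x \<in> K \<or> - x \<in> K"
    using total_convex_cone_extension by blast
  obtain a0 b0 where "a0 \<in> interior A" "b0 \<in> B" using assms by blast
  define e where "e = b0 - a0"
  define U where "U = (\<lambda>x. b0 - x) -` interior A"
  have U: "open U" "e \<in> U"
    using \<open>a0 \<in> interior A\<close> by (auto simp: U_def e_def intro!: open_vimage continuous_intros)
  have UD: "x \<in> D" if "x \<in> U" for x
  proof -
    have "b0 - x \<in> A" using that interior_subset by (auto simp: U_def)
    then have "b0 - (b0 - x) \<in> D" unfolding D_def using \<open>b0 \<in> B\<close> by blast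
    then show ?thesis by simp
  qed
  have unit: "\<exists>s. s *\<^sub>R e - x \<in> K" for x
  proof -
    obtain t where t: "t > 0" "e + t *\<^sub>R (- x) \<in> U" using open_absorbing[OF U] by blast
    then have "(1 / t) *\<^sub>R (e + t *\<^sub>R (- x)) \<in> K" using UD K(1) by (intro K(4)) auto
    then have "(1 / t) *\<^sub>R e - x \<in> K" using t by (simp add: scaleR_right_diff_distrib)
    then show ?thesis by blast
  qed
  have "e \<in> K" using UD U K(1) by blast
  have "\<exists>f. linear f \<and> f e = (1::real) \<and> (\<forall>x\<in>K. f x \<ge> 0)"
  proof (rule total_cone_positive_functional[of K e])
    show "0 \<notin> K" "e \<in> K" by fact+
    show "\<And>x y. x \<in> K \<Longrightarrow> y \<in> K \<Longrightarrow> x + y \<in> K" by (rule K(3))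
    show "\<And>c x. c > 0 \<Longrightarrow> x \<in> K \<Longrightarrow> c *\<^sub>R x \<in> K" by (rule K(4))
    show "\<And>x. x \<noteq> 0 \<Longrightarrow> x \<in> K \<or> - x \<in> K" by (rule K(5))
    show "\<And>x. \<exists>s. s *\<^sub>R e - x \<in> K" by (rule unit)
  qed blast
  then obtain f where f: "linear f" "f e = (1::real)" "\<And>x. x \<in> K \<Longrightarrow> f x \<ge> 0"
    by blast
  have "continuous_on UNIV f"
  proof (rule linear_continuous_if_bounded_below[OF f(1) U])
    show "0 \<le> f x" if "x \<in> U" for x using f(3) UD[OF that] K(1) by blast
  qed
  then have "f \<in> topological_dual" using f by (simp add: topological_dual_def)
  have le: "f a \<le> f b" if "a \<in> A" "b \<in> B" for a b
  proof -
    have "b - a \<in> K" using K(1) that unfolding D_def by blast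
    then show ?thesis using f(3)[of "b - a"] by (simp add: linear_diff[OF f(1)])
  qed
  have "A \<noteq> {}" using assms interior_subset by fastforce
  have bdd: "bdd_above (f ` A)" using le \<open>b0 \<in> B\<close> by (auto intro!: bdd_aboveI)
  show thesis
  proof (rule that[of f e "SUP a\<in>A. f a"])
    show "f \<in> topological_dual" by fact
    show "f e > 0" using f by simp
    show "\<And>a. a \<in> A \<Longrightarrow> f a \<le> (SUP a\<in>A. f a)" using bdd by (rule cSUP_upper[rotated])
    show "\<And>b. b \<in> B \<Longrightarrow> (SUP a\<in>A. f a) \<le> f b" using le \<open>A \<noteq> {}\<close> by (auto intro!: cSUP_least)
  qed
qed

text \<open>From an interior point one can still move a little in the direction \<open>d\<close>, along which the
functional grows. This turns weak separation into strict separation.\<close>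
lemma linear_less_on_interior:
  fixes f :: "'a::lctv_space \<Rightarrow> real"
  assumes f: "linear f" "f d > 0" and bound: "\<And>x. x \<in> S \<Longrightarrow> f x \<le> c" and z: "z \<in> interior S"
  shows "f z < c"
proof -
  obtain t where "t > 0" "z + t *\<^sub>R d \<in> interior S" using open_absorbing[OF open_interior z] by blast
  then have "f z + t * f d \<le> c"
    using bound interior_subset by (force simp: linear_add[OF f(1)] linear_scale[OF f(1)] dest: bound)
  moreover have "t * f d > 0" using \<open>t > 0\<close> f by simp
  ultimately show ?thesis by linarith
qed

section \<open>Products of locally convex spaces\<close>

text \<open>Functionals have to separate sets in \<open>(X \<times> Y) \<times> \<real>\<close>, so products must again be spaces of the
class. The classes of topological groups below it come first.\<close>
instance prod :: (topological_monoid_add, topological_monoid_add) topological_monoid_add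
proof
  fix a b :: "'a \<times> 'b"
  have "((\<lambda>p. (fst (fst p) + fst (snd p), snd (fst p) + snd (snd p))) \<longlongrightarrow>
      (fst a + fst b, snd a + snd b)) (nhds a \<times>\<^sub>F nhds b)"
    by (intro tendsto_Pair tendsto_add tendsto_fst tendsto_snd filterlim_fst filterlim_snd)
  then show "((\<lambda>p. fst p + snd p) \<longlongrightarrow> a + b) (nhds a \<times>\<^sub>F nhds b)"
    by (simp add: plus_prod_def)
qed

instance prod :: (topological_group_add, topological_group_add) topological_group_add
proof
  fix a :: "'a \<times> 'b"
  have "((\<lambda>p. (- fst p, - snd p)) \<longlongrightarrow> (- fst a, - snd a)) (nhds a)"
    by (intro tendsto_Pair tendsto_minus tendsto_fst tendsto_snd filterlim_ident)
  then show "(uminus \<longlongrightarrow> - a) (nhds a)"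
    by (simp add: uminus_prod_def[abs_def])
qed

instance prod :: (topological_comm_monoid_add, topological_comm_monoid_add) topological_comm_monoid_add ..

instance prod :: (topological_ab_group_add, topological_ab_group_add) topological_ab_group_add ..

instance prod :: (lctv_space, lctv_space) lctv_space
proof
  fix c :: real and x :: "'a \<times> 'b"
  have "((\<lambda>p. (fst p *\<^sub>R fst (snd p), fst p *\<^sub>R snd (snd p))) \<longlongrightarrow> (c *\<^sub>R fst x, c *\<^sub>R snd x))
      (nhds c \<times>\<^sub>F nhds x)"
    by (intro tendsto_Pair tendsto_scaleR_lctv tendsto_fst tendsto_snd filterlim_fst filterlim_snd)
  then show "((\<lambda>p. fst p *\<^sub>R snd p) \<longlongrightarrow> c *\<^sub>R x) (nhds c \<times>\<^sub>F nhds x)"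
    by (simp add: scaleR_prod_def)
next
  fix U :: "('a \<times> 'b) set" assume "open U" "0 \<in> U"
  then obtain A B where AB: "open A" "open B" "0 \<in> A" "0 \<in> B" "A \<times> B \<subseteq> U"
    by (elim open_prod_elim) (auto simp: zero_prod_def)
  obtain V where V: "open V" "0 \<in> V" "V \<subseteq> A" "convex V" using locally_convex_at_0[OF AB(1,3)] by blast
  obtain W where W: "open W" "0 \<in> W" "W \<subseteq> B" "convex W" using locally_convex_at_0[OF AB(2,4)] by blast
  have "open (V \<times> W) \<and> 0 \<in> V \<times> W \<and> V \<times> W \<subseteq> U \<and> convex (V \<times> W)"
    using V W AB by (auto simp: open_Times convex_Times zero_prod_def)
  then show "\<exists>V. open V \<and> 0 \<in> V \<and> V \<subseteq> U \<and>
      (\<forall>x\<in>V. \<forall>y\<in>V. \<forall>u\<ge>0. \<forall>v\<ge>0. u + v = 1 \<longrightarrow> u *\<^sub>R x + v *\<^sub>R y \<in> V)"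
    unfolding convex_def by (rule exI[of _ "V \<times> W"])
qed


section \<open>Conjugates and the marginal function\<close>

lemma ereal_minus_le_real_iff: "ereal a - m \<le> ereal r \<longleftrightarrow> ereal (a - r) \<le> m"
  by (cases m) (auto simp: algebra_simps)

text \<open>Real upper bounds determine an extended real number. Comparing conjugates through their real upper
bounds therefore avoids all arithmetic with infinite values.\<close>
lemma fenchel_conj_le_iff:
  "fenchel_conj f xs \<le> ereal r \<longleftrightarrow> (\<forall>x. ereal (xs x - r) \<le> f x)"
  by (simp add: fenchel_conj_def SUP_le_iff ereal_minus_le_real_iff)

lemma fenchel_conj_le_iff_epi:
  "fenchel_conj f xs \<le> ereal r \<longleftrightarrow> (\<forall>(x, l)\<in>epi f. xs x - l \<le> r)"
proof -
  have "ereal (xs x - r) \<le> f x \<longleftrightarrow> (\<forall>l. f x \<le> ereal l \<longrightarrow> xs x - l \<le> r)" for x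
  proof
    assume "ereal (xs x - r) \<le> f x"
    then show "\<forall>l. f x \<le> ereal l \<longrightarrow> xs x - l \<le> r"
      by (force dest: order_trans)
  next
    assume "\<forall>l. f x \<le> ereal l \<longrightarrow> xs x - l \<le> r"
    then show "ereal (xs x - r) \<le> f x"
      by - (rule ereal_le_real, simp add: algebra_simps)
  qed
  then show ?thesis by (auto simp: fenchel_conj_le_iff epi_def)
qed

lemma map_conj_le_iff:
  "map_conj F xs ys \<le> ereal r \<longleftrightarrow> (\<forall>(x, y)\<in>gph F. xs x + ys y \<le> r)"
  by (auto simp: map_conj_def SUP_le_iff)

text \<open>The conjugate of the marginal function is the conjugate, at \<open>(x\<^sup>*, 0)\<close>, of \<open>\<phi>\<close> restricted to the
graph: the infimum over \<open>y \<in> F x\<close> turns into part of the supremum.\<close>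
lemma fenchel_conj_marginal_le_iff:
  assumes "\<And>x. \<mu> x = (INF y \<in> F x. \<phi> (x, y))"
  shows "fenchel_conj \<mu> xs \<le> ereal r \<longleftrightarrow> (\<forall>(x, y)\<in>gph F. ereal (xs x - r) \<le> \<phi> (x, y))"
  by (auto simp: fenchel_conj_le_iff assms le_INF_iff gph_def)

text \<open>The Fenchel--Young inequality, applied to \<open>\<phi>\<close> and to the indicator function of the graph at the same
point: the terms in \<open>y\<^sup>*\<close> cancel. Every splitting of \<open>x\<^sup>*\<close> thus gives an upper bound.\<close>
lemma fenchel_conj_marginal_le_conj_inf_conv:
  assumes \<mu>: "\<And>x. \<mu> x = (INF y \<in> F x. \<phi> (x, y))"
  shows "fenchel_conj \<mu> xs \<le> conj_inf_conv \<phi> F xs"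
  unfolding conj_inf_conv_def
proof (rule Inf_greatest, clarify)
  fix x1 x2 :: "'a \<Rightarrow> real" and ys :: "'b \<Rightarrow> real"
  let ?M = "fenchel_conj \<phi> (pair_functional x1 ys) + map_conj F x2 (\<lambda>y. - ys y)"
  show "fenchel_conj \<mu> (\<lambda>x. x1 x + x2 x) \<le> ?M"
  proof (rule ereal_le_real)
    fix r assume r: "?M \<le> ereal r"
    have "ereal (x1 x + x2 x) - \<phi> (x, y) \<le> ereal r" if "(x, y) \<in> gph F" for x y
    proof -
      have "ereal (x1 x + ys y) - \<phi> (x, y) \<le> fenchel_conj \<phi> (pair_functional x1 ys)"
        unfolding fenchel_conj_def pair_functional_def by (rule SUP_upper2[of "(x, y)"]) auto
      moreover have "ereal (x2 x - ys y) \<le> map_conj F x2 (\<lambda>y. - ys y)"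
        unfolding map_conj_def using that by (intro SUP_upper2[of "(x, y)"]) auto
      ultimately have "(ereal (x1 x + ys y) - \<phi> (x, y)) + ereal (x2 x - ys y) \<le> ?M"
        by (rule add_mono)
      moreover have "(ereal (x1 x + ys y) - \<phi> (x, y)) + ereal (x2 x - ys y) = ereal (x1 x + x2 x) - \<phi> (x, y)"
        by (cases "\<phi> (x, y)") auto
      ultimately show ?thesis using r by simp
    qed
    then show "fenchel_conj \<mu> (\<lambda>x. x1 x + x2 x) \<le> ereal r"
      by (auto simp: fenchel_conj_marginal_le_iff[OF \<mu>] ereal_minus_le_real_iff)
  qed
qed

section \<open>The conjugate of the marginal function as an infimal convolution\<close>

lemma topological_dual_compose:
  assumes "f \<in> topological_dual" "linear g" "continuous_on UNIV g"
  shows "(\<lambda>x. f (g x)) \<in> topological_dual"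
  using assms linear_compose[of g f] continuous_on_compose2[of UNIV f UNIV g]
  by (auto simp: topological_dual_def o_def)

lemma topological_dual_scale_diff:
  assumes "f \<in> topological_dual" "g \<in> topological_dual"
  shows "(\<lambda>x. f x - g x) \<in> topological_dual" "(\<lambda>x. c * f x) \<in> topological_dual"
  using assms linear_compose_sub[of f g] linear_compose_scale_right[of f c]
  by (simp_all add: topological_dual_def continuous_on_diff continuous_on_mult_left)

text \<open>A real bound \<open>\<mu>\<^sup>*(x\<^sup>*) \<le> r\<close> says that on the graph the function \<open>\<phi>\<close> stays above \<open>\<langle>x\<^sup>*, x\<rangle> - r\<close>, so a
convex kernel of the epigraph is disjoint from the points over a convex kernel of the graph that lie
strictly below this affine function. A separating functional \<open>(u, v, \<alpha>)\<close> is at most \<open>\<gamma>\<close> on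
the whole epigraph and at least \<open>\<gamma>\<close> on the values of the affine function over the whole graph, since
epigraph and graph are contained in the closures of their kernels.
The qualification condition excludes a vertical hyperplane, that is, \<open>\<alpha> = 0\<close>: at the common point the
functional would be at least \<open>\<gamma>\<close> because of the graph and less than \<open>\<gamma>\<close> because the point is interior
to the epigraph. After scaling to \<open>\<alpha> = -1\<close>, the bound on the epigraph is a bound for \<open>\<phi>\<^sup>*\<close>, the
bound on the graph is one for \<open>F\<^sup>*\<close>, and the two add up to \<open>r\<close>.\<close>
lemma conj_inf_conv_le_fenchel_conj_marginal:
  fixes \<phi> :: "'a::lctv_space \<times> 'b::lctv_space \<Rightarrow> ereal"
  assumes \<mu>: "\<And>x. \<mu> x = (INF y \<in> F x. \<phi> (x, y))"
    and \<phi>: "int_nearly_convex_fun \<phi>" and F: "int_nearly_convex_map F"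
    and qual: "interior (epi \<phi>) \<inter> interior (gph F \<times> (UNIV :: real set)) \<noteq> {}"
    and xs: "xs \<in> topological_dual"
  shows "conj_inf_conv \<phi> F xs \<le> fenchel_conj \<mu> xs"
proof (rule ereal_le_real)
  fix r assume "fenchel_conj \<mu> xs \<le> ereal r"
  then have minor: "ereal (xs x - r) \<le> \<phi> (x, y)" if "(x, y) \<in> gph F" for x y
    using that by (auto simp: fenchel_conj_marginal_le_iff[OF \<mu>])
  obtain A where A: "convex A" "interior A \<noteq> {}" "A \<subseteq> epi \<phi>" "epi \<phi> \<subseteq> closure A"
    using \<phi> by (auto simp: int_nearly_convex_fun_def int_nearly_convex_set_def)
  obtain G where G: "convex G" "interior G \<noteq> {}" "G \<subseteq> gph F" "gph F \<subseteq> closure G"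
    using F by (auto simp: int_nearly_convex_map_def int_nearly_convex_set_def)
  \<comment> \<open>strict inequality, since the epigraph may touch the affine function\<close>
  define B where "B = {((x, y), l) | x y l. (x, y) \<in> G \<and> l < xs x - r}"
  have lin: "linear xs" using xs by (simp add: topological_dual_def)
  have "convex B"
    unfolding convex_def
  proof (intro ballI allI impI)
    fix p q :: "('a \<times> 'b) \<times> real" and u v :: real
    assume "p \<in> B" "q \<in> B" and uv: "u \<ge> 0" "v \<ge> 0" "u + v = 1"
    then obtain x y l x' y' l' where pq: "p = ((x, y), l)" "(x, y) \<in> G" "l < xs x - r"
        "q = ((x', y'), l')" "(x', y') \<in> G" "l' < xs x' - r" unfolding B_def by blast
    have "u * l + v * l' < u * (xs x - r) + v * (xs x' - r)"
    proof (cases "u = 0")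
      case True then show ?thesis using uv pq by simp
    next
      case False
      then have "u * l < u * (xs x - r)" using uv pq by (intro mult_strict_left_mono) auto
      moreover have "v * l' \<le> v * (xs x' - r)" using uv pq by (intro mult_left_mono) auto
      ultimately show ?thesis by linarith
    qed
    also have "\<dots> = xs (u *\<^sub>R x + v *\<^sub>R x') - (u + v) * r"
      by (simp add: linear_add[OF lin] linear_scale[OF lin] algebra_simps)
    finally have "u * l + v * l' < xs (u *\<^sub>R x + v *\<^sub>R x') - r" using uv by simp
    moreover have "u *\<^sub>R (x, y) + v *\<^sub>R (x', y') \<in> G" using convexD[OF G(1)] pq uv by blast
    ultimately show "u *\<^sub>R p + v *\<^sub>R q \<in> B" using pq by (auto simp: B_def)
  qed
  moreover have "B \<noteq> {}"
  proof -
    obtain x y where "(x, y) \<in> G" using G(2) interior_subset by fastforce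
    then have "((x, y), xs x - r - 1) \<in> B" by (simp add: B_def)
    then show ?thesis by blast
  qed
  moreover have "A \<inter> B = {}"
  proof -
    have False if "((x, y), l) \<in> epi \<phi>" "(x, y) \<in> G" "l < xs x - r" for x y l
    proof -
      have "(x, y) \<in> gph F" using that G(3) by blast
      then have "ereal (xs x - r) \<le> \<phi> (x, y)" by (rule minor)
      also have "\<dots> \<le> ereal l" using that by (simp add: epi_def)
      finally have "ereal (xs x - r) \<le> ereal l" .
      then show False using that by simp
    qed
    then show ?thesis using A(3) unfolding B_def by blast
  qed
  ultimately obtain f \<gamma> d where f: "f \<in> topological_dual" "f d > 0"
    and fA: "\<And>a. a \<in> A \<Longrightarrow> f a \<le> \<gamma>" and fB: "\<And>b. b \<in> B \<Longrightarrow> \<gamma> \<le> f b"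
    using separation_of_convex_sets[OF A(1,2)] by metis
  have lf: "linear f" and cf: "continuous_on UNIV f" using f by (auto simp: topological_dual_def)
  define u where "u x = f ((x, 0), 0)" for x
  define v where "v y = f ((0, y), 0)" for y
  define \<alpha> where "\<alpha> = f ((0, 0), 1)"
  have f_eq: "f ((x, y), l) = u x + v y + \<alpha> * l" for x y l
  proof -
    have "((x, y), l) = ((x, 0), 0) + ((0, y), 0) + l *\<^sub>R ((0, 0), 1)" by simp
    then show ?thesis unfolding u_def v_def \<alpha>_def
      by (metis linear_add[OF lf] linear_scale[OF lf] real_scaleR_def mult.commute)
  qed
  have dual: "u \<in> topological_dual" "v \<in> topological_dual"
    unfolding u_def v_def
    by (intro topological_dual_compose[OF f(1)] linearI continuous_intros; simp)+
  have f_epi: "f p \<le> \<gamma>" if "p \<in> epi \<phi>" for p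
  proof (rule continuous_le_on_closure[of A f p \<gamma>])
    show "continuous_on (closure A) f" using cf by (rule continuous_on_subset) simp
    show "p \<in> closure A" using A(4) that by blast
  qed (rule fA)
  have fG: "\<gamma> \<le> u x + v y + \<alpha> * l" if "(x, y) \<in> G" "l < xs x - r" for x y l
    using fB[of "((x, y), l)"] that by (auto simp: B_def f_eq)
  have "\<alpha> \<le> 0"
  proof (rule ccontr)
    assume "\<not> \<alpha> \<le> 0"
    obtain x y where xy: "(x, y) \<in> G" using G(2) interior_subset by fastforce
    \<comment> \<open>the points of \<open>B\<close> extend downwards without bound; go below the height where the functional takes the value \<open>\<gamma>\<close>\<close>
    define l where "l = min (xs x - r - 1) ((\<gamma> - u x - v y) / \<alpha> - 1)"
    have "\<gamma> \<le> u x + v y + \<alpha> * l" by (rule fG[OF xy]) (simp add: l_def)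
    also have "\<alpha> * l \<le> \<alpha> * ((\<gamma> - u x - v y) / \<alpha> - 1)"
      using \<open>\<not> \<alpha> \<le> 0\<close> by (intro mult_left_mono) (auto simp: l_def)
    also have "\<dots> = \<gamma> - u x - v y - \<alpha>" using \<open>\<not> \<alpha> \<le> 0\<close> by (simp add: field_simps)
    finally show False using \<open>\<not> \<alpha> \<le> 0\<close> by simp
  qed
  have f_graph: "\<gamma> \<le> u x + v y + \<alpha> * (xs x - r)" if "(x, y) \<in> gph F" for x y
  proof -
    let ?h = "\<lambda>p. - (u (fst p) + v (snd p) + \<alpha> * (xs (fst p) - r))"
    have "continuous_on UNIV (\<lambda>p::'a \<times> 'b. g (fst p))" "continuous_on UNIV (\<lambda>p::'a \<times> 'b. h (snd p))"
      if "g \<in> topological_dual" "h \<in> topological_dual" for g h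
      using that by (auto simp: topological_dual_def
          intro!: continuous_on_compose2[of UNIV g UNIV fst] continuous_on_compose2[of UNIV h UNIV snd]
            continuous_on_fst continuous_on_snd continuous_on_id)
    then have "continuous_on UNIV ?h"
      using dual xs by (intro continuous_intros) auto
    then have "continuous_on (closure G) ?h" by (rule continuous_on_subset) simp
    moreover have "(x, y) \<in> closure G" using G(4) that by blast
    moreover have "?h p \<le> - \<gamma>" if "p \<in> G" for p
    proof -
      obtain x y where p: "p = (x, y)" by (cases p)
      \<comment> \<open>the height \<open>xs x - r\<close> itself is excluded from \<open>B\<close>, so approach it from below\<close>
      have "\<gamma> - (u x + v y + \<alpha> * (xs x - r)) \<le> 0 + \<epsilon>" if "\<epsilon> > 0" for \<epsilon>
      proof (cases "\<alpha> = 0")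
        case True
        then show ?thesis using fG[of x y "xs x - r - 1"] that \<open>p \<in> G\<close> p by simp
      next
        case False
        then have "\<epsilon> / \<alpha> < 0" using \<open>\<alpha> \<le> 0\<close> that by (simp add: divide_less_0_iff)
        then have "\<gamma> \<le> u x + v y + \<alpha> * (xs x - r + \<epsilon> / \<alpha>)" using \<open>p \<in> G\<close> p by (intro fG) auto
        also have "\<dots> = u x + v y + \<alpha> * (xs x - r) + \<epsilon>" using False by (simp add: field_simps)
        finally show ?thesis by simp
      qed
      then have "\<gamma> - (u x + v y + \<alpha> * (xs x - r)) \<le> 0" by (rule field_le_epsilon)
      then show ?thesis using p by simp
    qed
    ultimately have "?h (x, y) \<le> - \<gamma>" by (rule continuous_le_on_closure[of G ?h "(x, y)" "- \<gamma>"])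
    then show ?thesis by simp
  qed
  have "\<alpha> \<noteq> 0"
  proof
    assume "\<alpha> = 0"
    obtain x y l where "((x, y), l) \<in> interior (epi \<phi>)" "((x, y), l) \<in> interior (gph F \<times> (UNIV :: real set))"
      using qual by auto
    then have "((x, y), l) \<in> interior (epi \<phi>)" "(x, y) \<in> gph F" using interior_subset by blast+
    then show False
      using linear_less_on_interior[OF lf f(2) f_epi] f_graph[of x y] \<open>\<alpha> = 0\<close>
      by (force simp: f_eq)
  qed
  define k where "k = - 1 / \<alpha>"
  have k: "k > 0" "k * \<alpha> = - 1" using \<open>\<alpha> \<le> 0\<close> \<open>\<alpha> \<noteq> 0\<close> by (auto simp: k_def field_simps)
  define x1 where "x1 x = k * u x" for x
  define ys where "ys y = k * v y" for y
  have dual': "x1 \<in> topological_dual" "ys \<in> topological_dual" "(\<lambda>x. xs x - x1 x) \<in> topological_dual"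
  proof -
    show "x1 \<in> topological_dual" "ys \<in> topological_dual"
      unfolding x1_def ys_def using topological_dual_scale_diff(2) dual by blast+
    then show "(\<lambda>x. xs x - x1 x) \<in> topological_dual" using topological_dual_scale_diff(1) xs by blast
  qed
  have scaled: "k * (u x + v y + \<alpha> * l) = x1 x + ys y - l" for x y l
    using k(2) by (simp add: x1_def ys_def algebra_simps flip: mult.assoc)
  have "x1 x + ys y - l \<le> k * \<gamma>" if "((x, y), l) \<in> epi \<phi>" for x y l
    using f_epi[OF that] k(1) by (simp add: f_eq flip: scaled)
  then have "fenchel_conj \<phi> (pair_functional x1 ys) \<le> ereal (k * \<gamma>)"
    by (auto simp: fenchel_conj_le_iff_epi pair_functional_def)
  moreover have "(xs x - x1 x) + - ys y \<le> r - k * \<gamma>" if "(x, y) \<in> gph F" for x y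
  proof -
    have "k * \<gamma> \<le> k * (u x + v y + \<alpha> * (xs x - r))" using f_graph[OF that] k(1) by simp
    then show ?thesis by (simp add: scaled)
  qed
  then have "map_conj F (\<lambda>x. xs x - x1 x) (\<lambda>y. - ys y) \<le> ereal (r - k * \<gamma>)"
    by (auto simp: map_conj_le_iff)
  ultimately have "fenchel_conj \<phi> (pair_functional x1 ys) + map_conj F (\<lambda>x. xs x - x1 x) (\<lambda>y. - ys y)
      \<le> ereal (k * \<gamma>) + ereal (r - k * \<gamma>)" by (rule add_mono)
  then have "fenchel_conj \<phi> (pair_functional x1 ys) + map_conj F (\<lambda>x. xs x - x1 x) (\<lambda>y. - ys y) \<le> ereal r"
    by simp
  then show "conj_inf_conv \<phi> F xs \<le> ereal r"
    unfolding conj_inf_conv_def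
  proof (rule Inf_lower2[rotated])
    have "(\<lambda>x. x1 x + (xs x - x1 x)) = xs" by simp
    then show "fenchel_conj \<phi> (pair_functional x1 ys) + map_conj F (\<lambda>x. xs x - x1 x) (\<lambda>y. - ys y)
        \<in> {fenchel_conj \<phi> (pair_functional x1 ys) + map_conj F x2 (\<lambda>y. - ys y) | x1 x2 ys.
            x1 \<in> topological_dual \<and> x2 \<in> topological_dual \<and> ys \<in> topological_dual \<and>
            (\<lambda>x. x1 x + x2 x) = xs}"
      using dual' by blast
  qed
qed

section \<open>Subgradients and dual solutions\<close>

lemma fenchel_conj_ge_minus_value_at_0:
  assumes "xs \<in> topological_dual"
  shows "- fenchel_conj f xs \<le> f 0"
proof -
  have "xs 0 = 0" using assms by (simp add: topological_dual_def linear_0)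
  then have "0 - f 0 \<le> fenchel_conj f xs"
    unfolding fenchel_conj_def by (intro SUP_upper2[of 0]) (auto simp: zero_ereal_def)
  then show ?thesis by (simp add: ereal_uminus_le_reorder)
qed

text \<open>A subgradient at \<open>0\<close> is a functional for which the supremum defining the conjugate is attained at
\<open>0\<close>, that is, for which the Fenchel--Young inequality at \<open>0\<close> is
an equality; finiteness of \<open>f 0\<close> is part of being subdifferentiable.\<close>
lemma subdiff_at_0_iff:
  assumes "xs \<in> topological_dual"
  shows "xs \<in> subdiff_at_0 f \<longleftrightarrow> - fenchel_conj f xs = f 0 \<and> \<bar>f 0\<bar> \<noteq> \<infinity>"
proof (cases "\<bar>f 0\<bar> = \<infinity>")
  case True
  then show ?thesis by (simp add: subdiff_at_0_def)
next
  case False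
  then obtain c where c: "f 0 = ereal c" by auto
  have "- fenchel_conj f xs = ereal c \<longleftrightarrow> ereal c \<le> - fenchel_conj f xs"
    using fenchel_conj_ge_minus_value_at_0[OF assms, of f] c by auto
  also have "\<dots> \<longleftrightarrow> fenchel_conj f xs \<le> ereal (- c)"
    using ereal_uminus_le_reorder ereal_minus_le_minus by (metis ereal_uminus_uminus uminus_ereal.simps(1))
  also have "\<dots> \<longleftrightarrow> (\<forall>x. ereal (xs x) \<le> f x - ereal c)"
  proof -
    have "ereal (xs x - - c) \<le> f x \<longleftrightarrow> ereal (xs x) \<le> f x - ereal c" for x
      by (cases "f x") auto
    then show ?thesis by (simp only: fenchel_conj_le_iff)
  qed
  finally show ?thesis using assms by (simp add: subdiff_at_0_def c)
qed

theorem theorem7p3: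
  fixes \<phi> :: "'x::lctv_space \<times> 'y::lctv_space \<Rightarrow> ereal"
    and F :: "'x \<Rightarrow> 'y set"
    and \<mu> :: "'x \<Rightarrow> ereal"
    and Vp Vd1 Vd2 :: ereal
    and x0 :: "'x \<Rightarrow> real"
  assumes "int_nearly_convex_fun \<phi>"
    and "int_nearly_convex_map F"
    and \<mu>: "\<And>x. \<mu> x = (INF y \<in> F x. \<phi> (x, y))"
    and "interior (epi \<phi>) \<inter> interior (gph F \<times> (UNIV :: real set)) \<noteq> {}"
    and Vp: "Vp = (INF y \<in> F 0. \<phi> (0, y))"
    and Vd1: "Vd1 = (SUP xs \<in> topological_dual. - fenchel_conj \<mu> xs)"
    and Vd2: "Vd2 = (SUP xs \<in> topological_dual. - conj_inf_conv \<phi> F xs)"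
    and "x0 \<in> topological_dual"
  shows "(x0 \<in> subdiff_at_0 \<mu> \<longleftrightarrow>
            solves_max (\<lambda>xs. - fenchel_conj \<mu> xs) topological_dual x0 \<and>
            Vp = Vd1 \<and> Vd1 = Vd2 \<and> \<bar>Vp\<bar> \<noteq> \<infinity>)
       \<and> (x0 \<in> subdiff_at_0 \<mu> \<longleftrightarrow>
            solves_max (\<lambda>xs. - conj_inf_conv \<phi> F xs) topological_dual x0 \<and>
            Vp = Vd1 \<and> Vd1 = Vd2 \<and> \<bar>Vp\<bar> \<noteq> \<infinity>)"
proof -
  have strong: "conj_inf_conv \<phi> F xs = fenchel_conj \<mu> xs" if "xs \<in> topological_dual" for xs
    by (intro antisym conj_inf_conv_le_fenchel_conj_marginal[OF \<mu>]
        fenchel_conj_marginal_le_conj_inf_conv[OF \<mu>] assms(1,2,4) that)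
  then have Vd: "Vd2 = Vd1" by (simp add: Vd1 Vd2)
  have Vp0: "Vp = \<mu> 0" by (simp add: Vp \<mu>)
  have weak: "Vd1 \<le> Vp"
    unfolding Vd1 Vp0 by (intro SUP_least fenchel_conj_ge_minus_value_at_0)
  have upper: "- fenchel_conj \<mu> x0 \<le> Vd1"
    unfolding Vd1 using \<open>x0 \<in> topological_dual\<close> by (rule SUP_upper)
  have max1: "solves_max (\<lambda>xs. - fenchel_conj \<mu> xs) topological_dual x0 \<longleftrightarrow> - fenchel_conj \<mu> x0 = Vd1"
    using \<open>x0 \<in> topological_dual\<close> by (simp add: solves_max_def Vd1)
  have max2: "solves_max (\<lambda>xs. - conj_inf_conv \<phi> F xs) topological_dual x0 \<longleftrightarrow> - fenchel_conj \<mu> x0 = Vd1"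
    using \<open>x0 \<in> topological_dual\<close> strong by (simp add: solves_max_def Vd1)
  have "x0 \<in> subdiff_at_0 \<mu> \<longleftrightarrow> - fenchel_conj \<mu> x0 = Vp \<and> \<bar>Vp\<bar> \<noteq> \<infinity>"
    using subdiff_at_0_iff[OF \<open>x0 \<in> topological_dual\<close>] by (simp add: Vp0)
  also have "\<dots> \<longleftrightarrow> - fenchel_conj \<mu> x0 = Vd1 \<and> Vp = Vd1 \<and> \<bar>Vp\<bar> \<noteq> \<infinity>"
    using weak upper by auto
  finally show ?thesis by (simp add: max1 max2 Vd)
qed

end
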